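(* Let $d\ge 1$ and $r\ge 1$ be integers and let $n=(d+1)(r-1)+1$. Let $a_1,\ldots,a_r$ be integers satisfying $a_i\le d+1$ for all $1\le i\le r$ and $\sum_{i=1}^r a_i=n$. Then there exists a set $X\subset\mathbb{R}^d$ of $n$ points such that for every Tverberg partition $X_1,\ldots,X_r$ of $X$ into $r$ parts, the cardinalities $|X_1|,\ldots,|X_r|$ are a permutation of the integers $a_1,\ldots,a_r$.
   Context: For a set $X\subset\mathbb{R}^d$ of $n=(d+1)(r-1)+1$ points, a Tverberg partition of $X$ is a partition of $X$ into $r$ pairwise disjoint subsets $X_1,\ldots,X_r$ (with union $X$) such that $\bigcap_{i=1}^r \mathrm{conv}(X_i)\neq\emptyset$, where $\mathrm{conv}$ denotes convex hull. *)

theory Defs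
  imports "HOL-Analysis.Analysis" "HOL-Combinatorics.Permutations"
begin

(* The parts are indexed by 1, ..., r; values of P outside this range are irrelevant.
   Nonemptiness of the parts is forced by the common point of the convex hulls. *)
definition tverberg_partition ::
  "(real ^ 'd) set \<Rightarrow> nat \<Rightarrow> (nat \<Rightarrow> (real ^ 'd) set) \<Rightarrow> bool" where
  "tverberg_partition X r P \<longleftrightarrow>
     disjoint_family_on P {1..r} \<and>
     (\<Union>i\<in>{1..r}. P i) = X \<and>
     (\<Inter>i\<in>{1..r}. convex hull (P i)) \<noteq> {}"

end

(* Put c i = d + 1 - a i, so that the c i are nonnegative and add up to d, and colour the d
   coordinates by b such that colour i is used c i times. Let X consist of r - 1 points on every
   positive coordinate half-axis and of the points y i whose coordinates are 0 at colour i and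
   -i elsewhere, for i = 1, ..., r. In every coordinate only r - 1 points of X are positive and
   only r - 1 are negative, so the common point of a Tverberg partition is 0. No convex
   combination of points on the half-axes is 0, so each of the r parts contains exactly one y i,
   and it then needs a point on half-axis j for every j that is not of colour i, which makes at
   least a i points. Since the a i add up to n, there are no others. *)
theory Submission
  imports Defs
begin

section \<open>Counting and convexity tools\<close>

text \<open>Blocks of the prescribed sizes are cut off \<open>S\<close> one index at a time. This
  supplies the colouring of the coordinates.\<close>

lemma exists_fibres_of_card:
  assumes "finite I" "finite S" "card S = (\<Sum>i\<in>I. c i)"
  shows "\<exists>b. b ` S \<subseteq> I \<and> (\<forall>i\<in>I. card {x\<in>S. b x = i} = c i)"
  using assms
proof (induction I arbitrary: S rule: finite_induct)
  case empty
  then show ?case by auto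
next
  case (insert i I)
  then have "c i \<le> card S" by simp
  then obtain T where T: "T \<subseteq> S" "card T = c i"
    using obtain_subset_with_card_n by metis
  have "finite T"
    using T insert.prems finite_subset by blast
  then have "card (S - T) = (\<Sum>i\<in>I. c i)"
    using insert T by (simp add: card_Diff_subset)
  then obtain b where b: "b ` (S - T) \<subseteq> I" "\<forall>k\<in>I. card {x\<in>S - T. b x = k} = c k"
    using insert.IH insert.prems by (metis finite_Diff)
  define b' where "b' x = (if x \<in> T then i else b x)" for x
  \<comment> \<open>No point outside \<open>T\<close> gets colour \<open>i\<close>: \<open>b\<close>
    maps \<open>S - T\<close> into \<open>I\<close>, and \<open>i\<close> is a new index.\<close>
  have "{x\<in>S. b' x = i} = T"
    using T b insert.hyps unfolding b'_def by auto
  moreover have "{x\<in>S. b' x = k} = {x\<in>S - T. b x = k}" if "k \<in> I" for k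
    using that insert.hyps unfolding b'_def by auto
  ultimately show ?case
    using T b by (intro exI[of _ b']) (auto simp: b'_def)
qed

text \<open>Picking a point of \<open>S\<close> from each member is injective by disjointness. Used
  as a pigeonhole: fewer than \<open>r\<close> points cannot meet \<open>r\<close> disjoint
  parts.\<close>

lemma card_ge_if_meets_disjoint_family:
  assumes "disjoint_family_on P I" "finite S" "\<And>i. i \<in> I \<Longrightarrow> P i \<inter> S \<noteq> {}"
  shows "card I \<le> card S"
proof -
  obtain g where g: "\<And>i. i \<in> I \<Longrightarrow> g i \<in> P i \<inter> S"
    using bchoice[of I "\<lambda>i x. x \<in> P i \<inter> S"] assms(3) by blast
  then have "inj_on g I"
    using assms(1) unfolding disjoint_family_on_def inj_on_def by (metis IntD1 disjoint_iff)
  then show ?thesis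
    using g assms(2) by (intro card_inj_on_le[of g]) auto
qed

text \<open>With a half-line as \<open>C\<close>, this is how a linear functional of known sign on
  \<open>P\<close> restricts the hull.\<close>

lemma linear_convex_hull_mem:
  assumes "linear f" "convex C" "z \<in> convex hull P" "\<And>x. x \<in> P \<Longrightarrow> f x \<in> C"
  shows "f z \<in> C"
proof -
  have "f z \<in> convex hull (f ` P)"
    using assms(1,3) by (metis convex_hull_linear_image imageI)
  also have "\<dots> \<subseteq> C"
    using assms(2,4) by (intro hull_minimal) auto
  finally show ?thesis .
qed

lemma eq_if_sum_le:
  fixes f g :: "'a \<Rightarrow> int"
  assumes "finite I" "\<And>i. i \<in> I \<Longrightarrow> f i \<le> g i" "sum g I \<le> sum f I" "i \<in> I"
  shows "f i = g i"
proof (rule ccontr)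
  assume "f i \<noteq> g i"
  then have "f i < g i"
    using assms(2,4) by (simp add: order_less_le)
  then have "sum f I < sum g I"
    using assms by (intro sum_strict_mono_ex1) auto
  then show False
    using assms(3) by simp
qed

lemma linear_sum_vec: "linear (\<lambda>x :: real ^ 'd. \<Sum>k\<in>UNIV. x $ k)"
  by (rule linearI) (simp_all add: sum.distrib sum_distrib_left)

section \<open>The point configuration\<close>

text \<open>The heights only keep the points distinct; what matters is that they are positive and
  one fewer than the parts.\<close>

definition axis_points :: "nat \<Rightarrow> 'd \<Rightarrow> (real ^ 'd) set" where
  "axis_points r j = (\<lambda>t. axis j (real t)) ` {1..<r}"

definition neg_point :: "('d \<Rightarrow> nat) \<Rightarrow> nat \<Rightarrow> real ^ 'd" where
  "neg_point b i = (\<chi> j. if b j = i then 0 else - real i)"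

definition tverberg_config :: "nat \<Rightarrow> ('d \<Rightarrow> nat) \<Rightarrow> (real ^ 'd) set" where
  "tverberg_config r b = neg_point b ` {1..r} \<union> (\<Union>j. axis_points r j)"

lemma neg_point_nth: "neg_point b i $ j = (if b j = i then 0 else - real i)"
  by (simp add: neg_point_def)

lemma axis_pointsE:
  assumes "x \<in> axis_points r j"
  obtains t where "t > 0" "t < r" "x = axis j (real t)"
proof -
  from assms obtain t where "t \<in> {1..<r}" "x = axis j (real t)"
    unfolding axis_points_def by (rule imageE)
  then show ?thesis
    by (intro that[of t]) auto
qed

lemma inj_neg_point: "inj_on (neg_point (b :: 'd::finite \<Rightarrow> nat)) {1..r}"
proof (rule inj_onI)
  fix i k assume ik: "i \<in> {1..r}" "k \<in> {1..r}" "neg_point b i = neg_point b k"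
  \<comment> \<open>Any single coordinate separates these points, and \<open>undefined\<close> is
    just some coordinate. Its value is minus the index, or 0 at the index that is its colour;
    indices start at 1, so 0 is not taken twice.\<close>
  have "neg_point b i $ undefined = neg_point b k $ undefined"
    using ik by simp
  then show "i = k"
    using ik(1,2) by (auto simp: neg_point_nth split: if_splits)
qed

lemma finite_axis_points [simp]: "finite (axis_points r j)"
  by (simp add: axis_points_def)

lemma card_axis_points: "card (axis_points r j) = r - 1"
  unfolding axis_points_def by (subst card_image) (auto simp: inj_on_def axis_eq_axis)

lemma axis_points_disjoint:
  assumes "x \<in> axis_points r j" "x \<in> axis_points r k"
  shows "j = k"
  using assms by (auto elim!: axis_pointsE simp: axis_eq_axis)

lemma neg_point_notin_axis_points: "neg_point b i \<notin> axis_points r j"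
proof
  assume "neg_point b i \<in> axis_points r j"
  then obtain t where "t > 0" "neg_point b i = axis j (real t)"
    by (auto elim: axis_pointsE)
  then have "neg_point b i $ j > 0" by simp
  then show False by (simp add: neg_point_nth split: if_splits)
qed

lemma card_tverberg_config:
  assumes "r \<ge> 1"
  shows "card (tverberg_config r (b :: 'd::finite \<Rightarrow> nat)) = (CARD('d) + 1) * (r - 1) + 1"
proof -
  have "card (\<Union>j :: 'd. axis_points r j) = CARD('d) * (r - 1)"
    by (subst card_UN_disjoint) (auto simp: card_axis_points dest: axis_points_disjoint)
  moreover have "card (neg_point b ` {1..r}) = r"
    using card_image[OF inj_neg_point, of b r] by simp
  moreover have "neg_point b ` {1..r} \<inter> (\<Union>j. axis_points r j) = {}"
    using neg_point_notin_axis_points by auto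
  ultimately show ?thesis
    using assms unfolding tverberg_config_def by (subst card_Un_disjoint) auto
qed

lemma tverberg_configE:
  assumes "x \<in> tverberg_config r b"
  obtains (neg) i where "i \<in> {1..r}" "x = neg_point b i"
    | (pos) j where "x \<in> axis_points r j"
  using assms unfolding tverberg_config_def by auto

lemma tverberg_config_pos:
  assumes "x \<in> tverberg_config r b" "x $ j > 0"
  shows "x \<in> axis_points r j"
  using assms(1)
proof (cases rule: tverberg_configE)
  case (neg i)
  then show ?thesis using assms(2) by (simp add: neg_point_nth split: if_splits)
next
  case (pos k)
  then have "j = k" using assms(2) by (auto elim!: axis_pointsE simp: axis_def split: if_splits)
  then show ?thesis using pos by simp
qed

text \<open>The index \<open>b j\<close> drops out because \<open>neg_point b (b j)\<close> vanishes
  at \<open>j\<close>.\<close>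

lemma tverberg_config_neg:
  assumes "x \<in> tverberg_config r b" "x $ j < 0"
  shows "x \<in> neg_point b ` ({1..r} - {b j})"
  using assms(1)
proof (cases rule: tverberg_configE)
  case (neg i)
  then show ?thesis using assms(2) by (auto simp: neg_point_nth split: if_splits)
next
  case (pos k)
  then show ?thesis using assms(2) by (auto elim!: axis_pointsE simp: axis_def split: if_splits)
qed

lemma sum_axis_point:
  assumes "x \<in> axis_points r j"
  shows "(\<Sum>k\<in>UNIV. x $ k) > (0 :: real)"
  using assms by (auto elim!: axis_pointsE simp: axis_def)

section \<open>The common point is the origin\<close>

lemma tverberg_partition_config_common_point:
  fixes b :: "'d::finite \<Rightarrow> nat"
  assumes r: "r \<ge> 1" and b: "b ` UNIV \<subseteq> {1..r}"
    and P: "tverberg_partition (tverberg_config r b) r P"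
    and z: "\<And>i. i \<in> {1..r} \<Longrightarrow> z \<in> convex hull (P i)"
  shows "z = 0"
proof -
  have disj: "disjoint_family_on P {1..r}" and sub: "\<And>i. i \<in> {1..r} \<Longrightarrow> P i \<subseteq> tverberg_config r b"
    using P unfolding tverberg_partition_def by auto
  have lin: "linear (\<lambda>x :: real ^ 'd. x $ j)" for j
    by (simp add: bounded_linear.linear bounded_linear_vec_nth)
  \<comment> \<open>\<open>C\<close> will be a closed half-line missing \<open>z $ j\<close>, and
    \<open>S\<close> contains all configuration points outside it. A part whose hull contains
    \<open>z\<close> cannot lie over \<open>C\<close>, so all \<open>r\<close> disjoint parts meet
    \<open>S\<close>, which is too small.\<close>
  have few: False
    if S: "finite S" "card S < r" and C: "convex C" "z $ j \<notin> C"
      and CS: "\<And>x. x \<in> tverberg_config r b \<Longrightarrow> x $ j \<notin> C \<Longrightarrow> x \<in> S" for S and C :: "real set" and j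
  proof -
    have "P i \<inter> S \<noteq> {}" if i: "i \<in> {1..r}" for i
      using linear_convex_hull_mem[OF lin C(1) z[OF i], of j] C(2) CS sub[OF i] by blast
    from card_ge_if_meets_disjoint_family[OF disj S(1) this] S(2) show False
      by simp
  qed
  have "z $ j = 0" for j
  proof (rule ccontr)
    assume "z $ j \<noteq> 0"
    then consider "z $ j > 0" | "z $ j < 0" by linarith
    then show False
    proof cases
      case 1
      show False
      proof (rule few)
        show "card (axis_points r j) < r"
          using r by (simp add: card_axis_points)
        show "convex {..0 :: real}" "z $ j \<notin> {..0}"
          using 1 by auto
      qed (auto intro: tverberg_config_pos)
    next
      case 2
      \<comment> \<open>Removing \<open>b j\<close> lowers the count below \<open>r\<close> only
        because it is one of the indices.\<close>
      have "b j \<in> {1..r}"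
        using b by blast
      then have "card ({1..r} - {b j}) < r"
        using r by simp
      then have *: "card (neg_point b ` ({1..r} - {b j})) < r"
        using card_image_le[of "{1..r} - {b j}" "neg_point b"] by simp
      show False
      proof (rule few[OF _ *])
        show "convex {0 :: real..}" "z $ j \<notin> {0..}"
          using 2 by auto
        show "x \<in> neg_point b ` ({1..r} - {b j})"
          if "x \<in> tverberg_config r b" "x $ j \<notin> {0..}" for x
          using that by (intro tverberg_config_neg) auto
      qed simp
    qed
  qed
  then show ?thesis
    by (simp add: vec_eq_iff)
qed

section \<open>What each part must contain\<close>

text \<open>The coordinate sum is positive on all half-axis points, so it separates 0 from any hull
  of such points alone.\<close>

lemma neg_point_in_part:
  fixes b :: "'d::finite \<Rightarrow> nat"
  assumes "Q \<subseteq> tverberg_config r b" "0 \<in> convex hull Q"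
  shows "\<exists>i\<in>{1..r}. neg_point b i \<in> Q"
proof (rule ccontr)
  assume *: "\<not> ?thesis"
  have "(\<Sum>k\<in>UNIV. x $ k) \<in> {0 :: real<..}" if x: "x \<in> Q" for x
  proof -
    have "x \<in> tverberg_config r b"
      using assms(1) x by auto
    then show ?thesis
      using * x by (cases rule: tverberg_configE) (auto intro: sum_axis_point)
  qed
  from linear_convex_hull_mem[OF linear_sum_vec _ assms(2) this] show False
    by simp
qed

text \<open>Without a point on half-axis \<open>j\<close>, some linear functional is positive on all
  of \<open>Q\<close>, excluding 0 from its hull. The coordinate sum fails only at
  \<open>neg_point b i\<close>; subtracting a multiple of coordinate \<open>j\<close>, which is
  negative there, repairs this and changes nothing on the other half-axes.\<close>

lemma axis_point_in_part:
  fixes b :: "'d::finite \<Rightarrow> nat"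
  assumes Q: "Q \<subseteq> tverberg_config r b" "0 \<in> convex hull Q"
    and i: "\<And>k. k \<in> {1..r} \<Longrightarrow> neg_point b k \<in> Q \<Longrightarrow> k = i"
    and j: "b j \<noteq> i"
  shows "Q \<inter> axis_points r j \<noteq> {}"
proof
  assume *: "Q \<inter> axis_points r j = {}"
  \<comment> \<open>The weight \<open>d + 1\<close> makes \<open>f\<close> positive at \<open>neg_point b i\<close>, whose coordinates sum to at least \<open>- d i\<close>.\<close>
  define f :: "real ^ 'd \<Rightarrow> real" where "f x = (\<Sum>k\<in>UNIV. x $ k) - (real CARD('d) + 1) * x $ j" for x
  have lin: "linear f"
    unfolding f_def
    by (rule linearI) (simp_all add: sum.distrib right_diff_distrib distrib_left flip: sum_distrib_left)
  have pos: "f x \<in> {0<..}" if x: "x \<in> Q" for x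
  proof -
    have "x \<in> tverberg_config r b"
      using Q x by auto
    then show ?thesis
    proof (cases rule: tverberg_configE)
      case (neg k)
      then have k: "k = i" "k > 0"
        using i x by auto
      have "(\<Sum>l\<in>UNIV. x $ l) \<ge> (\<Sum>l\<in>(UNIV :: 'd set). - real k)"
        using neg by (intro sum_mono) (simp add: neg_point_nth)
      moreover have "x $ j = - real k"
        using neg k j by (simp add: neg_point_nth)
      ultimately show ?thesis
        using k by (simp add: f_def algebra_simps)
    next
      case (pos k)
      then have "k \<noteq> j"
        using * x by auto
      then have "x $ j = 0"
        using pos by (auto elim!: axis_pointsE simp: axis_def)
      then show ?thesis
        using sum_axis_point[OF pos] by (simp add: f_def)
    qed
  qed
  have "f 0 \<in> {0<..}"
    by (rule linear_convex_hull_mem[OF lin _ Q(2) pos]) simp_all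
  then show False
    by (simp add: f_def)
qed

text \<open>One point from each half-axis not of colour \<open>i\<close>, together with
  \<open>neg_point b i\<close>, gives distinct points: the half-axes are disjoint and avoid
  \<open>neg_point b i\<close>.\<close>

lemma card_part_ge:
  fixes b :: "'d::finite \<Rightarrow> nat"
  assumes Q: "Q \<subseteq> tverberg_config r b" "0 \<in> convex hull Q" and fin: "finite Q"
    and mem: "neg_point b i \<in> Q"
    and i: "\<And>k. k \<in> {1..r} \<Longrightarrow> neg_point b k \<in> Q \<Longrightarrow> k = i"
  shows "card {j. b j \<noteq> i} + 1 \<le> card Q"
proof -
  obtain g where g: "\<And>j. b j \<noteq> i \<Longrightarrow> g j \<in> Q \<inter> axis_points r j"
    using bchoice[of "{j. b j \<noteq> i}" "\<lambda>j x. x \<in> Q \<inter> axis_points r j"] axis_point_in_part[OF Q i]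
    by blast
  have "inj_on g {j. b j \<noteq> i}"
  proof (rule inj_onI)
    fix j k assume "j \<in> {j. b j \<noteq> i}" "k \<in> {j. b j \<noteq> i}" "g j = g k"
    then have "g j \<in> axis_points r j" "g j \<in> axis_points r k"
      using g[of j] g[of k] by auto
    then show "j = k"
      by (rule axis_points_disjoint)
  qed
  moreover have "neg_point b i \<notin> g ` {j. b j \<noteq> i}"
  proof
    assume "neg_point b i \<in> g ` {j. b j \<noteq> i}"
    then obtain j where "b j \<noteq> i" "neg_point b i = g j"
      by blast
    then show False
      using g[of j] neg_point_notin_axis_points[of b i r j] by simp
  qed
  ultimately have "card {j. b j \<noteq> i} + 1 = card (insert (neg_point b i) (g ` {j. b j \<noteq> i}))"
    by (simp add: card_image)
  also have "\<dots> \<le> card Q"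
    using g mem fin by (intro card_mono) auto
  finally show ?thesis .
qed

text \<open>\<sigma> sends a part to the index of a \<open>neg_point\<close> in it. Disjointness
  makes it injective, finiteness makes it surjective, and surjectivity in turn leaves no part with a
  second \<open>neg_point\<close>.\<close>

lemma tverberg_partition_config_cards:
  fixes b :: "'d::finite \<Rightarrow> nat"
  assumes r: "r \<ge> 1" and b: "b ` UNIV \<subseteq> {1..r}"
    and P: "tverberg_partition (tverberg_config r b) r P"
  shows "\<exists>\<sigma>. \<sigma> permutes {1..r} \<and> (\<forall>i\<in>{1..r}. card {j. b j \<noteq> \<sigma> i} + 1 \<le> card (P i))"
proof -
  have disj: "disjoint_family_on P {1..r}" and sub: "\<And>i. i \<in> {1..r} \<Longrightarrow> P i \<subseteq> tverberg_config r b"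
    using P unfolding tverberg_partition_def by auto
  obtain z where z: "\<And>i. i \<in> {1..r} \<Longrightarrow> z \<in> convex hull (P i)"
    using P unfolding tverberg_partition_def by blast
  have zero: "0 \<in> convex hull (P i)" if "i \<in> {1..r}" for i
    using tverberg_partition_config_common_point[OF r b P z] z that by auto
  have "\<exists>\<sigma>. \<forall>i\<in>{1..r}. \<sigma> i \<in> {1..r} \<and> neg_point b (\<sigma> i) \<in> P i"
    using neg_point_in_part[OF sub zero] by (intro bchoice) blast
  then obtain s where s: "\<And>i. i \<in> {1..r} \<Longrightarrow> s i \<in> {1..r} \<and> neg_point b (s i) \<in> P i"
    by blast
  \<comment> \<open>The choice \<open>s\<close> is arbitrary outside \<open>{1..r}\<close>, whereas
    \<open>permutes\<close> demands the identity there.\<close>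
  define \<sigma> where "\<sigma> i = (if i \<in> {1..r} then s i else i)" for i
  have \<sigma>: "\<sigma> i \<in> {1..r}" "neg_point b (\<sigma> i) \<in> P i" if "i \<in> {1..r}" for i
    using s that by (auto simp: \<sigma>_def)
  have same: "i = k" if "i \<in> {1..r}" "k \<in> {1..r}" "x \<in> P i" "x \<in> P k" for i k x
    using disj that unfolding disjoint_family_on_def by blast
  have inj: "inj_on \<sigma> {1..r}"
    using \<sigma>(2) same by (metis inj_onI)
  then have im: "\<sigma> ` {1..r} = {1..r}"
    using \<sigma>(1) by (intro endo_inj_surj) auto
  have "\<sigma> permutes {1..r}"
    using inj im by (intro bij_imp_permutes) (auto simp: bij_betw_def \<sigma>_def)
  moreover have "card {j. b j \<noteq> \<sigma> i} + 1 \<le> card (P i)" if i: "i \<in> {1..r}" for i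
  proof (rule card_part_ge[OF sub[OF i] zero[OF i] _ \<sigma>(2)[OF i]])
    show "finite (P i)"
      using sub[OF i] by (rule finite_subset) (simp add: tverberg_config_def)
    show "k = \<sigma> i" if k: "k \<in> {1..r}" "neg_point b k \<in> P i" for k
    proof -
      \<comment> \<open>Now \<open>neg_point b k\<close> lies in both \<open>P l\<close> and
        \<open>P i\<close>, which forces \<open>l = i\<close>.\<close>
      obtain l where "l \<in> {1..r}" "k = \<sigma> l"
        using im k(1) by blast
      then show ?thesis
        using same \<sigma>(2) i k(2) by blast
    qed
  qed
  ultimately show ?thesis by blast
qed

section \<open>Choice of the colouring and the final count\<close>

theorem theorem1:
  fixes r n :: nat and a :: "nat \<Rightarrow> int"
  assumes "r \<ge> 1"
    and "n = (CARD('d::finite) + 1) * (r - 1) + 1"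
    and "\<forall>i\<in>{1..r}. a i \<le> int (CARD('d) + 1)"
    and "(\<Sum>i\<in>{1..r}. a i) = int n"
  shows "\<exists>X :: (real ^ 'd) set. card X = n \<and>
           (\<forall>P. tverberg_partition X r P \<longrightarrow>
             (\<exists>\<sigma>. \<sigma> permutes {1..r} \<and> (\<forall>i\<in>{1..r}. int (card (P i)) = a (\<sigma> i))))"
proof -
  \<comment> \<open>The number of coordinates at which \<open>neg_point b i\<close> is to vanish.
    The bound on \<open>a i\<close> ensures that \<open>nat\<close> truncates nothing.\<close>
  define c where "c i = nat (int (CARD('d) + 1) - a i)" for i
  have "int (\<Sum>i\<in>{1..r}. c i) = (\<Sum>i\<in>{1..r}. int (CARD('d) + 1) - a i)"
    using assms(3) unfolding c_def of_nat_sum by (intro sum.cong) auto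
  also have "\<dots> = int r * (int CARD('d) + 1) - int n"
    using assms(4) by (simp add: sum_subtractf)
  also have "\<dots> = int CARD('d)"
    using assms(1,2) by (cases r) (simp_all add: algebra_simps)
  finally have "CARD('d) = (\<Sum>i\<in>{1..r}. c i)"
    by (simp only: of_nat_eq_iff)
  then obtain b :: "'d \<Rightarrow> nat"
    where b: "b ` UNIV \<subseteq> {1..r}" "\<forall>i\<in>{1..r}. card {j. b j = i} = c i"
    using exists_fibres_of_card[of "{1..r}" "UNIV :: 'd set" c] by auto
  have a: "a i = int (card {j. b j \<noteq> i} + 1)" if i: "i \<in> {1..r}" for i
  proof -
    have "{j. b j \<noteq> i} = UNIV - {j. b j = i}" by auto
    then have "card {j. b j \<noteq> i} = CARD('d) - c i"
      using b(2) i by (simp add: card_Diff_subset)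
    \<comment> \<open>A fibre is no larger than the set of coordinates, so the natural subtraction
      above is exact; this amounts to \<open>a i\<close> being at least 1.\<close>
    moreover have "c i \<le> CARD('d)"
      using b(2) i by (metis card_mono finite subset_UNIV)
    ultimately show ?thesis
      using assms(3) i by (auto simp: c_def)
  qed
  let ?X = "tverberg_config r b"
  have X: "card ?X = n"
    using card_tverberg_config[OF assms(1)] assms(2) by simp
  have "\<exists>\<sigma>. \<sigma> permutes {1..r} \<and> (\<forall>i\<in>{1..r}. int (card (P i)) = a (\<sigma> i))"
    if P: "tverberg_partition ?X r P" for P
  proof -
    obtain \<sigma> where \<sigma>: "\<sigma> permutes {1..r}"
      and le: "\<And>i. i \<in> {1..r} \<Longrightarrow> card {j. b j \<noteq> \<sigma> i} + 1 \<le> card (P i)"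
      using tverberg_partition_config_cards[OF assms(1) b(1) P] by blast
    have disj: "disjoint_family_on P {1..r}" and un: "(\<Union>i\<in>{1..r}. P i) = ?X"
      using P unfolding tverberg_partition_def by auto
    have "finite ?X"
      by (simp add: tverberg_config_def)
    then have fin: "\<forall>i\<in>{1..r}. finite (P i)"
      using un by (metis UN_upper finite_subset)
    have "(\<Sum>i\<in>{1..r}. card (P i)) = n"
      using X un fin disj card_UN_disjoint[of "{1..r}" P] by (simp add: disjoint_family_on_def)
    \<comment> \<open>Permuting the indices preserves the sum of the \<open>a i\<close>, so both
      totals are \<open>n\<close> and the lower bounds on the part sizes have no slack.\<close>
    then have "(\<Sum>i\<in>{1..r}. int (card (P i))) \<le> (\<Sum>i\<in>{1..r}. a (\<sigma> i))"
      using assms(4) sum.permute[OF \<sigma>, of a] by (simp add: o_def flip: of_nat_sum)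
    moreover have "a (\<sigma> i) \<le> int (card (P i))" if i: "i \<in> {1..r}" for i
      using a[of "\<sigma> i"] le[OF i] permutes_in_image[OF \<sigma>] i by simp
    ultimately have "a (\<sigma> i) = int (card (P i))" if "i \<in> {1..r}" for i
      using that by (intro eq_if_sum_le[of "{1..r}" "\<lambda>i. a (\<sigma> i)"]) auto
    with \<sigma> show ?thesis by auto
  qed
  with X show ?thesis by blast
qed

end
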